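(* Let $q$ be a rational number. (i) For $q_2=q^2-2=C_2(q)$ we have $\Pi_0(q_2)=\Pi_0(q)\cup\Pi_1(q)$ and $\Pi_k(q_2)=\Pi_{k+1}(q)$ for $k=1,2,\dots$. (ii) If $q_n=C_n(q)$ for an odd $n\ge1$, then $\Pi_j(q_n)=\Pi_j(q)$ for all $j=0,1,2,\dots$. (iii) $\Pi_i(-q)=\Pi_{1-i}(q)$ for $i=0,1$, and $\Pi_j(-q)=\Pi_j(q)$ for $j=2,3,\dots$.
   Context: Chebyshev polynomials: $U_n\in\mathbb Z[q]$ are defined by $U_0=0$, $U_1=1$, $U_{n+1}=qU_n-U_{n-1}$; $C_n=U_{n+1}-U_{n-1}$ (so $C_0=2$, $C_1=q$, $C_{n+1}=qC_n-C_{n-1}$); for odd $n=2k+1$, $V_n=U_{k+1}-U_k$ and $W_n=U_{k+1}+U_k$. For a rational $q=a/b$ in lowest terms and a prime $p\nmid b$, congruences mod $p$ of rationals with denominators prime to $p$ are understood in $\mathbb F_p$. $\mathcal D(q)$ is the set of prime divisors of $b$; $\Pi$ is the set of odd primes. For $p\in\Pi\setminus\mathcal D(q)$: $p\in\Pi_0(q)$ if $W_n(q)\equiv0\bmod p$ for some odd $n\ge1$; $p\in\Pi_1(q)$ if $V_n(q)\equiv0\bmod p$ for some odd $n\ge1$; $p\in\Pi_{2+k}(q)$ ($k\ge0$) if $C_{2^kn}(q)\equiv0\bmod p$ for some odd $n\ge1$. *)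

theory Defs
  imports "HOL-Number_Theory.Number_Theory" "HOL-Computational_Algebra.Computational_Algebra"
begin

fun cheb_U :: "nat \<Rightarrow> int poly" where
  "cheb_U 0 = 0"
| "cheb_U (Suc 0) = 1"
| "cheb_U (Suc (Suc n)) = [:0, 1:] * cheb_U (Suc n) - cheb_U n"

text \<open>The value at \<open>0\<close> comes from running the recurrence of \<open>U\<close> backwards:
  \<open>U\<^sub>-\<^sub>1 = -1\<close>, hence \<open>C\<^sub>0 = U\<^sub>1 - U\<^sub>-\<^sub>1 = 2\<close>.\<close>
fun cheb_C :: "nat \<Rightarrow> int poly" where
  "cheb_C 0 = 2"
| "cheb_C (Suc n) = cheb_U (Suc (Suc n)) - cheb_U n"

lemma cheb_C_1: "cheb_C 1 = [:0, 1:]"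
  by simp

lemma cheb_C_rec: "cheb_C (Suc (Suc n)) = [:0, 1:] * cheb_C (Suc n) - cheb_C n"
  by (cases n) (simp_all add: algebra_simps one_pCons numeral_poly)

text \<open>\<open>V\<^sub>n\<close> and \<open>W\<^sub>n\<close> are only meaningful for odd \<open>n = 2k + 1\<close>, where \<open>k = n div 2\<close>.\<close>
definition cheb_V :: "nat \<Rightarrow> int poly" where
  "cheb_V n = cheb_U (n div 2 + 1) - cheb_U (n div 2)"

definition cheb_W :: "nat \<Rightarrow> int poly" where
  "cheb_W n = cheb_U (n div 2 + 1) + cheb_U (n div 2)"

definition eval_rat :: "int poly \<Rightarrow> rat \<Rightarrow> rat" where
  "eval_rat f q = poly (map_poly of_int f) q"

definition rat_num :: "rat \<Rightarrow> int" where
  "rat_num x = fst (quotient_of x)"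

definition rat_den :: "rat \<Rightarrow> int" where
  "rat_den x = snd (quotient_of x)"

text \<open>The residue class of \<open>a / b\<close> in \<open>F\<^sub>p\<close>, represented in \<open>{0..<p}\<close>;
  meaningful only if \<open>p\<close> is a prime not dividing the reduced denominator \<open>b\<close>.\<close>
definition rat_residue :: "nat \<Rightarrow> rat \<Rightarrow> int" where
  "rat_residue p x = (rat_num x * modular_inverse (int p) (rat_den x)) mod int p"

definition rat_cong :: "rat \<Rightarrow> rat \<Rightarrow> nat \<Rightarrow> bool" where
  "rat_cong x y p \<longleftrightarrow>
     \<not> int p dvd rat_den x \<and> \<not> int p dvd rat_den y \<and> rat_residue p x = rat_residue p y"

definition den_primes :: "rat \<Rightarrow> nat set" where
  "den_primes q = {p. prime p \<and> int p dvd rat_den q}"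

definition odd_primes :: "nat set" where
  "odd_primes = {p. prime p \<and> odd p}"

fun cheb_Pi :: "nat \<Rightarrow> rat \<Rightarrow> nat set" where
  "cheb_Pi 0 q =
     {p \<in> odd_primes - den_primes q. \<exists>n. odd n \<and> rat_cong (eval_rat (cheb_W n) q) 0 p}"
| "cheb_Pi (Suc 0) q =
     {p \<in> odd_primes - den_primes q. \<exists>n. odd n \<and> rat_cong (eval_rat (cheb_V n) q) 0 p}"
| "cheb_Pi (Suc (Suc k)) q =
     {p \<in> odd_primes - den_primes q. \<exists>n. odd n \<and> rat_cong (eval_rat (cheb_C (2 ^ k * n)) q) 0 p}"

end

theory Submission
  imports Defs
begin

text \<open>Let \<open>c = t + 1/t\<close> be the residue of \<open>q\<close> modulo \<open>p\<close>. Membership of \<open>p\<close> in \<open>\<Pi>\<^sub>j\<close> says that the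
  multiplicative order of \<open>t\<close> has \<open>2\<close>-adic valuation \<open>j\<close>, and passing from \<open>q\<close> to \<open>C\<^sub>n(q)\<close> or \<open>-q\<close>
  replaces \<open>t\<close> by \<open>t\<^sup>n\<close> or \<open>-t\<close>. Since \<open>C\<^sub>n(c) = t\<^sup>n + t\<^sup>-\<^sup>n\<close>, the valuation can be read off from which
  \<open>C\<^sub>n(c)\<close> equal \<open>\<plusminus>2\<close>, so no field extension is needed: the identities
  \<open>C\<^sub>n - 2 = (x - 2) W\<^sub>n\<^sup>2\<close> and \<open>C\<^sub>n + 2 = (x + 2) V\<^sub>n\<^sup>2\<close> for odd \<open>n\<close>, and \<open>C\<^sub>m \<circ> C\<^sub>n = C\<^sub>m\<^sub>n\<close>, suffice.
  When \<open>c = 2\<close> (or \<open>c = -2\<close>) the first (second) identity degenerates, but then \<open>n = p\<close> is a zero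
  of \<open>W\<^sub>n\<close> (\<open>V\<^sub>n\<close>) modulo \<open>p\<close>.\<close>

section \<open>Product, composition and parity identities for \<open>cheb_C\<close>\<close>

lemma cheb_C_rec_poly:
  "poly (cheb_C (Suc (Suc n))) x = x * poly (cheb_C (Suc n)) x - poly (cheb_C n) x"
  by (simp only: cheb_C_rec poly_diff poly_mult) simp

lemma poly_cheb_C_0 [simp]: "poly (cheb_C 0) x = 2"
  by simp

lemma poly_cheb_C_1 [simp]: "poly (cheb_C (Suc 0)) x = x"
  by simp

declare cheb_C.simps [simp del]

text \<open>At \<open>x = t + 1/t\<close> this is the expansion of
  \<open>(t^(d+n) + t^-(d+n)) * (t^n + t^-n)\<close>. Naming the difference \<open>d\<close> of the
  indices avoids truncated subtraction.\<close>

lemma cheb_C_product: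
  "poly (cheb_C (d + 2 * n)) x + poly (cheb_C d) x = poly (cheb_C (d + n)) x * poly (cheb_C n) x"
proof (induction n arbitrary: d rule: induct_nat_012)
  case 0
  then show ?case by simp
next
  case 1
  then show ?case by (simp add: cheb_C_rec_poly)
next
  case (ge2 n)
  let ?c = "\<lambda>k. poly (cheb_C k) x"
  \<comment> \<open>The hypotheses are taken at \<open>d + 2\<close> and \<open>d + 1\<close>, so
    that both products contain the factor with index \<open>d + n + 2\<close> of the goal.\<close>
  have "?c (Suc (Suc (d + 2 * n))) + ?c (Suc (Suc d)) = ?c (Suc (Suc (d + n))) * ?c n"
    using ge2.IH(1)[of "Suc (Suc d)"] by simp
  moreover have "?c (Suc (Suc (Suc (d + 2 * n)))) + ?c (Suc d) = ?c (Suc (Suc (d + n))) * ?c (Suc n)"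
    using ge2.IH(2)[of "Suc d"] by simp
  ultimately have "?c (Suc (Suc (d + n))) * ?c (Suc (Suc n))
      = x * (?c (Suc (Suc (Suc (d + 2 * n)))) + ?c (Suc d)) - (?c (Suc (Suc (d + 2 * n))) + ?c (Suc (Suc d)))"
    by (simp only: cheb_C_rec_poly[of n] right_diff_distrib mult.left_commute)
  also have "\<dots> = ?c (Suc (Suc (Suc (Suc (d + 2 * n))))) + ?c d"
    by (simp only: cheb_C_rec_poly[of d] cheb_C_rec_poly[of "Suc (Suc (d + 2 * n))"])
      (simp add: algebra_simps)
  finally show ?case by simp
qed

lemma cheb_C_double: "poly (cheb_C (2 * n)) x = (poly (cheb_C n) x)\<^sup>2 - 2"
  using cheb_C_product[of 0 n x] by (simp add: power2_eq_square)

lemma cheb_C_comp: "poly (cheb_C n) (poly (cheb_C m) x) = poly (cheb_C (n * m)) x"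
proof (induction n rule: induct_nat_012)
  case (ge2 n)
  then show ?case
    using cheb_C_product[of "n * m" m x]
    by (simp add: cheb_C_rec_poly algebra_simps mult_2_right)
qed simp_all

lemma cheb_C_minus: "poly (cheb_C n) (- x) = (- 1) ^ n * poly (cheb_C n) x"
  by (induction n rule: induct_nat_012) (simp_all add: cheb_C_rec_poly algebra_simps)

lemma cheb_C_at_2: "poly (cheb_C n) 2 = 2"
  by (induction n rule: induct_nat_012) (simp_all add: cheb_C_rec_poly)

lemma cheb_C_at_minus_2: "odd n \<Longrightarrow> poly (cheb_C n) (- 2) = - 2"
  using cheb_C_minus[of n 2] by (simp add: cheb_C_at_2)

section \<open>Factorizations of \<open>C_n - 2\<close> and \<open>C_n + 2\<close>, and the
  degenerate points\<close>

text \<open>The quadratic form \<open>P^2 - x*P*Q + Q^2\<close> is invariant under the recurrence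
  step \<open>(P, Q) -> (x*P - Q, P)\<close> and equals 1 at the start
  \<open>(1, 0)\<close>.\<close>

lemma cheb_U_norm:
  "(poly (cheb_U (Suc k)) x)\<^sup>2 + (poly (cheb_U k) x)\<^sup>2
    = 1 + x * poly (cheb_U (Suc k)) x * poly (cheb_U k) x"
  by (induction k) (simp_all add: algebra_simps power2_eq_square)

lemma cheb_C_eq_U: "poly (cheb_C k) x = 2 * poly (cheb_U (Suc k)) x - x * poly (cheb_U k) x"
  by (cases k) (simp_all add: cheb_C.simps)

lemma cheb_C_odd:
  "poly (cheb_C (2 * k + 1)) x = poly (cheb_C (Suc k)) x * poly (cheb_C k) x - x"
  using cheb_C_product[of 1 k x] by simp

text \<open>With \<open>x = s^2 + s^-2\<close>, both \<open>C_n - 2 = (s^n - s^-n)^2\<close> and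
  \<open>x - 2 = (s - s^-1)^2\<close> are squares, and \<open>W_n\<close> is the quotient of their
  roots.\<close>

lemma cheb_C_W:
  assumes "odd n"
  shows "poly (cheb_C n) x - 2 = (x - 2) * (poly (cheb_W n) x)\<^sup>2"
proof -
  obtain k where n: "n = 2 * k + 1" using assms by (elim oddE)
  let ?P = "poly (cheb_U (Suc k)) x" and ?Q = "poly (cheb_U k) x"
  \<comment> \<open>The two sides differ by a multiple of the norm relation, which vanishes.\<close>
  have "poly (cheb_C (2 * k + 1)) x - 2 - (x - 2) * (?P + ?Q)\<^sup>2
      = (x + 2) * (?P\<^sup>2 + ?Q\<^sup>2 - (1 + x * ?P * ?Q))"
    unfolding cheb_C_odd unfolding cheb_C_eq_U by (simp add: algebra_simps power2_eq_square)
  then have "poly (cheb_C (2 * k + 1)) x - 2 = (x - 2) * (?P + ?Q)\<^sup>2"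
    by (simp only: cheb_U_norm) simp
  then show ?thesis by (simp add: n cheb_W_def)
qed

lemma cheb_C_V:
  assumes "odd n"
  shows "poly (cheb_C n) x + 2 = (x + 2) * (poly (cheb_V n) x)\<^sup>2"
proof -
  obtain k where n: "n = 2 * k + 1" using assms by (elim oddE)
  let ?P = "poly (cheb_U (Suc k)) x" and ?Q = "poly (cheb_U k) x"
  have "poly (cheb_C (2 * k + 1)) x + 2 - (x + 2) * (?P - ?Q)\<^sup>2
      = (x - 2) * (?P\<^sup>2 + ?Q\<^sup>2 - (1 + x * ?P * ?Q))"
    unfolding cheb_C_odd unfolding cheb_C_eq_U by (simp add: algebra_simps power2_eq_square)
  then have "poly (cheb_C (2 * k + 1)) x + 2 = (x + 2) * (?P - ?Q)\<^sup>2"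
    by (simp only: cheb_U_norm) simp
  then show ?thesis by (simp add: n cheb_V_def)
qed

lemma cheb_W_at_2:
  assumes "odd n"
  shows "poly (cheb_W n) 2 = int n"
proof -
  have "poly (cheb_U k) 2 = int k" for k
    by (induction k rule: induct_nat_012) simp_all
  moreover obtain k where "n = 2 * k + 1" using assms by (elim oddE)
  ultimately show ?thesis by (simp add: cheb_W_def del: cheb_U.simps)
qed

lemma cheb_V_at_minus_2:
  assumes "odd n"
  shows "poly (cheb_V n) (- 2) = (- 1) ^ (n div 2) * int n"
proof -
  have "poly (cheb_U k) (- 2) = - ((- 1) ^ k * int k)" for k
    by (induction k rule: induct_nat_012) (simp_all add: algebra_simps)
  moreover obtain k where "n = 2 * k + 1" using assms by (elim oddE)
  ultimately show ?thesis by (simp add: cheb_V_def algebra_simps del: cheb_U.simps)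
qed

section \<open>Polynomial values at congruent arguments and at rationals\<close>

lemma diff_dvd_poly_diff: "x - y dvd poly f x - poly f (y :: 'a :: comm_ring_1)"
proof (induction f)
  case (pCons a f)
  have "poly (pCons a f) x - poly (pCons a f) y 
      = (x - y) * poly f x + y * (poly f x - poly f y)"
    by (simp add: algebra_simps)
  with pCons.IH show ?case by simp
qed simp

lemma eval_rat_0 [simp]: "eval_rat 0 q = 0"
  by (simp add: eval_rat_def)

lemma eval_rat_pCons [simp]: "eval_rat (pCons a f) q = of_int a + q * eval_rat f q"
  by (simp add: eval_rat_def map_poly_pCons)

lemma eval_rat_diff: "eval_rat (f - g) q = eval_rat f q - eval_rat g q"
proof -
  have "map_poly rat_of_int (f - g) = map_poly of_int f - map_poly of_int g"
    by (simp add: poly_eq_iff coeff_map_poly)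
  then show ?thesis by (simp add: eval_rat_def)
qed

lemma eval_rat_cheb_C_0 [simp]: "eval_rat (cheb_C 0) q = 2"
  by (simp add: cheb_C.simps numeral_poly)

lemma eval_rat_cheb_C_1 [simp]: "eval_rat (cheb_C (Suc 0)) q = q"
  using cheb_C_1 by simp

lemma eval_rat_cheb_C_rec:
  "eval_rat (cheb_C (Suc (Suc n))) q = q * eval_rat (cheb_C (Suc n)) q - eval_rat (cheb_C n) q"
  by (simp add: cheb_C_rec eval_rat_diff)

lemma eval_rat_cheb_C_2: "eval_rat (cheb_C 2) q = q\<^sup>2 - 2"
  by (simp add: numeral_2_eq_2 eval_rat_cheb_C_rec)

section \<open>Reduction of rationals modulo \<open>p\<close>, and primes in denominators\<close>

text \<open>A relation rather than a function: \<open>c\<close> may be any integer representing the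
  residue class, so ring operations need no normalization and no modular inverse.\<close>

definition reduces_to :: "nat \<Rightarrow> rat \<Rightarrow> int \<Rightarrow> bool" where
  "reduces_to p x c \<longleftrightarrow> \<not> int p dvd rat_den x \<and> int p dvd rat_num x - c * rat_den x"

lemma rat_den_pos: "rat_den x > 0"
  by (simp add: rat_den_def quotient_of_denom_pos')

lemma rat_num_den: "x = of_int (rat_num x) / of_int (rat_den x)"
  by (rule quotient_of_div) (simp add: rat_num_def rat_den_def)

lemma coprime_rat_num_den: "coprime (rat_num x) (rat_den x)"
  by (rule quotient_of_coprime) (simp add: rat_num_def rat_den_def)

text \<open>The fraction \<open>a / b\<close> need not be reduced: the reduced denominator divides
  \<open>b\<close>. Sums and products can thus be treated over the product of the
  denominators.\<close>

lemma reduces_toI: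
  assumes p: "prime p" and x: "x = of_int a / of_int b"
    and b: "\<not> int p dvd b" and a: "int p dvd a - c * b"
  shows "reduces_to p x c"
proof -
  have "b \<noteq> 0" using b by auto
  moreover have "of_int (rat_num x) / of_int (rat_den x) = (of_int a / of_int b :: rat)"
    using x rat_num_den[of x] by simp
  ultimately have "of_int (rat_num x * b) = (of_int (a * rat_den x) :: rat)"
    using rat_den_pos[of x] by (simp add: field_simps)
  then have eq: "rat_num x * b = a * rat_den x"
    by (simp only: of_int_eq_iff)
  then have "rat_den x dvd rat_num x * b" by simp
  then have "rat_den x dvd b"
    using coprime_rat_num_den[of x] by (simp add: coprime_commute coprime_dvd_mult_right_iff)
  then have "\<not> int p dvd rat_den x" using b dvd_trans by blast
  moreover have "(rat_num x - c * rat_den x) * b = (a - c * b) * rat_den x"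
    using eq by (simp add: algebra_simps)
  then have "int p dvd (rat_num x - c * rat_den x) * b" using a by simp
  then have "int p dvd rat_num x - c * rat_den x"
    using b p by (simp add: prime_dvd_mult_iff)
  ultimately show ?thesis by (simp add: reduces_to_def)
qed

lemma reduces_to_of_int: "prime p \<Longrightarrow> reduces_to p (of_int a) a"
  by (rule reduces_toI[of p _ a 1]) (auto simp: prime_nat_iff)

lemma reduces_to_add:
  assumes p: "prime p" and x: "reduces_to p x c" and y: "reduces_to p y d"
  shows "reduces_to p (x + y) (c + d)"
proof (rule reduces_toI[OF p])
  let ?a = "rat_num x" and ?b = "rat_den x" and ?a' = "rat_num y" and ?b' = "rat_den y"
  have "x + y = of_int ?a / of_int ?b + of_int ?a' / of_int ?b'"
    by (rule arg_cong2[where f = "(+)", OF rat_num_den rat_num_den])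
  then show "x + y = of_int (?a * ?b' + ?a' * ?b) / of_int (?b * ?b')"
    using rat_den_pos[of x] rat_den_pos[of y] by (simp add: field_simps)
  show "\<not> int p dvd ?b * ?b'"
    using p x y by (simp add: reduces_to_def prime_dvd_mult_iff)
  have "?a * ?b' + ?a' * ?b - (c + d) * (?b * ?b')
      = (?a - c * ?b) * ?b' + (?a' - d * ?b') * ?b" by (simp add: algebra_simps)
  then show "int p dvd ?a * ?b' + ?a' * ?b - (c + d) * (?b * ?b')"
    using x y by (simp add: reduces_to_def)
qed

lemma reduces_to_mult:
  assumes p: "prime p" and x: "reduces_to p x c" and y: "reduces_to p y d"
  shows "reduces_to p (x * y) (c * d)"
proof (rule reduces_toI[OF p])
  let ?a = "rat_num x" and ?b = "rat_den x" and ?a' = "rat_num y" and ?b' = "rat_den y"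
  have "x * y = (of_int ?a / of_int ?b) * (of_int ?a' / of_int ?b')"
    by (rule arg_cong2[where f = "(*)", OF rat_num_den rat_num_den])
  then show "x * y = of_int (?a * ?a') / of_int (?b * ?b')" by simp
  show "\<not> int p dvd ?b * ?b'"
    using p x y by (simp add: reduces_to_def prime_dvd_mult_iff)
  have "?a * ?a' - (c * d) * (?b * ?b')
      = (?a - c * ?b) * ?a' + (?a' - d * ?b') * (c * ?b)" by (simp add: algebra_simps)
  then show "int p dvd ?a * ?a' - (c * d) * (?b * ?b')"
    using x y by (simp add: reduces_to_def)
qed

lemma reduces_to_minus:
  assumes "prime p" and "reduces_to p x c"
  shows "reduces_to p (- x) (- c)"
  using reduces_to_mult[OF assms(1) reduces_to_of_int[OF assms(1), of "- 1"] assms(2)] by simp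

lemma reduces_to_eval_rat:
  assumes "prime p" and "reduces_to p q c"
  shows "reduces_to p (eval_rat f q) (poly f c)"
proof (induction f)
  case 0
  show ?case using reduces_to_of_int[OF assms(1), of 0] by simp
next
  case (pCons a f)
  then show ?case
    by (simp add: reduces_to_add reduces_to_mult reduces_to_of_int assms)
qed

lemma ex_reduces_to:
  assumes "prime p" and "\<not> int p dvd rat_den x"
  shows "\<exists>c. reduces_to p x c"
proof -
  have "coprime (rat_den x) (int p)"
    using assms prime_imp_coprime[of "int p" "rat_den x"] by (simp add: coprime_commute)
  then obtain i where "[rat_den x * i = 1] (mod int p)"
    using cong_solve_coprime_int by blast
  then have "int p dvd rat_num x * (1 - rat_den x * i)"
    by (simp add: cong_iff_dvd_diff dvd_diff_commute)
  then have "int p dvd rat_num x - (rat_num x * i) * rat_den x"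
    by (simp add: algebra_simps)
  then show ?thesis using assms(2) by (auto simp: reduces_to_def)
qed

lemma rat_cong_0_iff:
  assumes p: "prime p" and x: "reduces_to p x c"
  shows "rat_cong x 0 p \<longleftrightarrow> int p dvd c"
proof -
  let ?i = "modular_inverse (int p) (rat_den x)"
  have nd: "\<not> int p dvd rat_den x" and cd: "int p dvd rat_num x - c * rat_den x"
    using x by (simp_all add: reduces_to_def)
  have "coprime (rat_den x) (int p)"
    using p nd prime_imp_coprime[of "int p" "rat_den x"] by (simp add: coprime_commute)
  then have "[?i * rat_den x = 1] (mod int p)"
    by (rule cong_modular_inverse2)
  then have "\<not> int p dvd ?i"
    using p by (metis cong_dvd_iff dvd_mult2 not_prime_unit prime_nat_int_transfer)
  have "rat_cong x 0 p \<longleftrightarrow> int p dvd rat_num x * ?i"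
    using nd p by (auto simp: rat_cong_def rat_residue_def rat_num_def[of 0] rat_den_def[of 0]
        prime_nat_iff dvd_eq_mod_eq_0)
  also have "\<dots> \<longleftrightarrow> int p dvd rat_num x"
    using \<open>\<not> int p dvd ?i\<close> p by (simp add: prime_dvd_mult_iff)
  also have "\<dots> \<longleftrightarrow> int p dvd c * rat_den x"
    using cd by (metis dvd_diff_commute zdvd_zdiffD)
  also have "\<dots> \<longleftrightarrow> int p dvd c"
    using nd p by (simp add: prime_dvd_mult_iff)
  finally show ?thesis .
qed

text \<open>Clearing denominators: for \<open>n \<ge> 1\<close> the numerator over \<open>b\<^sup>n\<close> is \<open>a\<^sup>n\<close> modulo \<open>b\<close>,
  because \<open>C\<^sub>n\<close> is monic of degree \<open>n\<close>.\<close>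
lemma cheb_C_homogenized:
  fixes a b :: int
  assumes "b \<noteq> 0"
  shows "\<exists>m. of_int b ^ Suc n * eval_rat (cheb_C (Suc n)) (of_int a / of_int b)
    = of_int (a ^ Suc n + b * m)"
proof (induction n rule: induct_nat_012)
  case 0
  show ?case using assms by (intro exI[of _ 0]) simp
next
  case 1
  show ?case using assms
    \<comment> \<open>Here \<open>C_2\<close> gives
      \<open>b^2 * (q^2 - 2) = a^2 - 2 * b^2\<close>.\<close>
    by (intro exI[of _ "- 2 * b"]) (simp add: eval_rat_cheb_C_rec field_simps)
next
  case (ge2 n)
  then obtain m m' where
    m: "of_int b ^ Suc n * eval_rat (cheb_C (Suc n)) (of_int a / of_int b) = rat_of_int (a ^ Suc n + b * m)"
    and m': "of_int b ^ Suc (Suc n) * eval_rat (cheb_C (Suc (Suc n))) (of_int a / of_int b)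
      = rat_of_int (a ^ Suc (Suc n) + b * m')"
    by blast
  have "of_int b ^ Suc (Suc (Suc n)) * eval_rat (cheb_C (Suc (Suc (Suc n)))) (of_int a / of_int b)
    = of_int a * (of_int b ^ Suc (Suc n) * eval_rat (cheb_C (Suc (Suc n))) (of_int a / of_int b))
      - of_int b ^ 2 * (of_int b ^ Suc n * eval_rat (cheb_C (Suc n)) (of_int a / of_int b))"
    using assms by (simp add: eval_rat_cheb_C_rec[of "Suc n"] field_simps power2_eq_square)
  also have "\<dots> = rat_of_int (a * (a ^ Suc (Suc n) + b * m') - b ^ 2 * (a ^ Suc n + b * m))"
    unfolding m m' by simp
  also have "a * (a ^ Suc (Suc n) + b * m') - b ^ 2 * (a ^ Suc n + b * m)
    = a ^ Suc (Suc (Suc n)) + b * (a * m' - b * (a ^ Suc n + b * m))"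
    by (simp add: algebra_simps power2_eq_square)
  finally show ?case by blast
qed

text \<open>Together with \<open>reduces_to_eval_rat\<close> this shows that passing to
  \<open>C_n(q)\<close> neither removes nor adds excluded primes. If \<open>p\<close> left the
  denominator, the leading term \<open>a^n\<close> would be divisible by \<open>p\<close>, against
  coprimality.\<close>

lemma den_cheb_C:
  assumes p: "prime p" and n: "n > 0" and q: "int p dvd rat_den q"
  shows "int p dvd rat_den (eval_rat (cheb_C n) q)"
proof (rule ccontr)
  define a b x where "a = rat_num q" and "b = rat_den q" and "x = eval_rat (cheb_C n) q"
  assume "\<not> int p dvd rat_den (eval_rat (cheb_C n) q)"
  then have nd: "\<not> int p dvd rat_den x" by (simp add: x_def)
  have "b \<noteq> 0" "q = of_int a / of_int b"
    using rat_den_pos[of q] rat_num_den[of q] by (auto simp: a_def b_def)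
  then obtain m where "of_int b ^ n * x = rat_of_int (a ^ n + b * m)"
    using cheb_C_homogenized[of b "n - 1" a] n by (auto simp: x_def)
  moreover have "of_int (rat_den x) * x = rat_of_int (rat_num x)"
    using rat_num_den[of x] rat_den_pos[of x] by (simp add: field_simps)
  ultimately have "rat_of_int (rat_den x * (a ^ n + b * m)) = of_int (b ^ n * rat_num x)"
    by (metis mult.left_commute of_int_mult of_int_power)
  then have eq: "rat_den x * (a ^ n + b * m) = b ^ n * rat_num x"
    by (simp only: of_int_eq_iff)
  have pb: "int p dvd b" using q by (simp add: b_def)
  with n have "int p dvd b ^ n * rat_num x" by (simp add: dvd_trans)
  then have "int p dvd a ^ n + b * m"
    using nd p by (simp add: eq[symmetric] prime_dvd_mult_iff)
  with pb have "int p dvd a ^ n" by (simp add: dvd_add_left_iff)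
  with p have "int p dvd a" by (simp add: prime_dvd_power_iff n)
  with pb coprime_rat_num_den[of q] have "is_unit (int p)"
    unfolding a_def b_def using coprime_common_divisor by blast
  with p show False by (auto simp: prime_nat_iff)
qed

section \<open>The 2-adic valuation of the order, and its link with \<open>cheb_Pi\<close>\<close>

text \<open>For \<open>c = t + 1/t\<close> modulo \<open>p\<close>, \<open>C_m(c) = 2\<close> means
  \<open>t^m = 1\<close> and \<open>C_m(c) = -2\<close> means \<open>t^m = -1\<close>. For odd
  \<open>p\<close> the clauses therefore express valuation \<open>0\<close> and
  \<open>k + 1\<close>.\<close>

fun cheb_order_val :: "nat \<Rightarrow> nat \<Rightarrow> int \<Rightarrow> bool" where
  "cheb_order_val p 0 c \<longleftrightarrow> (\<exists>n. odd n \<and> int p dvd poly (cheb_C n) c - 2)"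
| "cheb_order_val p (Suc k) c \<longleftrightarrow> (\<exists>n. odd n \<and> int p dvd poly (cheb_C (2 ^ k * n)) c + 2)"

lemma ex_cheb_W_dvd_iff:
  assumes "prime p" "odd p"
  shows "(\<exists>n. odd n \<and> int p dvd poly (cheb_W n) c) \<longleftrightarrow> cheb_order_val p 0 c"
proof
  assume "\<exists>n. odd n \<and> int p dvd poly (cheb_W n) c"
  then show "cheb_order_val p 0 c" by (auto simp: cheb_C_W power2_eq_square)
next
  assume "cheb_order_val p 0 c"
  then obtain n where n: "odd n" "int p dvd (c - 2) * (poly (cheb_W n) c)\<^sup>2"
    by (auto simp: cheb_C_W)
  then consider "int p dvd c - 2" | "int p dvd poly (cheb_W n) c"
    using assms(1) by (auto simp: prime_dvd_mult_iff prime_dvd_power_iff)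
  then show "\<exists>n. odd n \<and> int p dvd poly (cheb_W n) c"
  proof cases
    case 1
    then have "int p dvd poly (cheb_W p) c - poly (cheb_W p) 2"
      using diff_dvd_poly_diff dvd_trans by blast
    then have "int p dvd poly (cheb_W p) c"
      unfolding cheb_W_at_2[OF assms(2)] by (rule zdvd_zdiffD) simp
    with assms(2) show ?thesis by blast
  qed (use n in blast)
qed

lemma ex_cheb_V_dvd_iff:
  assumes "prime p" "odd p"
  shows "(\<exists>n. odd n \<and> int p dvd poly (cheb_V n) c) \<longleftrightarrow> cheb_order_val p 1 c"
proof
  assume "\<exists>n. odd n \<and> int p dvd poly (cheb_V n) c"
  then show "cheb_order_val p 1 c" by (auto simp: cheb_C_V power2_eq_square)
next
  assume "cheb_order_val p 1 c"
  then obtain n where n: "odd n" "int p dvd (c + 2) * (poly (cheb_V n) c)\<^sup>2"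
    by (auto simp: cheb_C_V)
  then consider "int p dvd c - (- 2)" | "int p dvd poly (cheb_V n) c"
    using assms(1) by (auto simp: prime_dvd_mult_iff prime_dvd_power_iff)
  then show "\<exists>n. odd n \<and> int p dvd poly (cheb_V n) c"
  proof cases
    case 1
    then have "int p dvd poly (cheb_V p) c - poly (cheb_V p) (- 2)"
      using diff_dvd_poly_diff dvd_trans by blast
    \<comment> \<open>The value is \<open>p\<close> up to sign.\<close>
    moreover have "int p dvd poly (cheb_V p) (- 2)"
      by (simp only: cheb_V_at_minus_2[OF assms(2)] dvd_triv_right)
    ultimately have "int p dvd poly (cheb_V p) c"
      by (rule zdvd_zdiffD)
    with assms(2) show ?thesis by blast
  qed (use n in blast)
qed

lemma cheb_Pi_iff:
  assumes p: "prime p" "odd p" and q: "reduces_to p q c"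
  shows "p \<in> cheb_Pi j q \<longleftrightarrow> cheb_order_val p j c"
proof -
  have "p \<in> odd_primes - den_primes q"
    using p q by (auto simp: odd_primes_def den_primes_def reduces_to_def)
  moreover have "rat_cong (eval_rat f q) 0 p \<longleftrightarrow> int p dvd poly f c" for f
    using rat_cong_0_iff[OF p(1) reduces_to_eval_rat[OF p(1) q]] .
  \<comment> \<open>Since \<open>C_(2m) + 2 = C_m^2\<close>, a zero of \<open>C_m\<close> is a value
    \<open>-2\<close> of \<open>C_(2m)\<close>; this turns the clause of \<open>cheb_Pi\<close> for
    \<open>k + 2\<close> into that of \<open>cheb_order_val\<close>.\<close>
  moreover have "int p dvd poly (cheb_C (2 ^ k * n)) c \<longleftrightarrow>
      int p dvd poly (cheb_C (2 ^ Suc k * n)) c + 2" for k n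
    using p(1) cheb_C_double[of "2 ^ k * n" c]
    by (simp add: prime_dvd_power_iff mult.assoc)
  ultimately show ?thesis
    using ex_cheb_W_dvd_iff[OF p] ex_cheb_V_dvd_iff[OF p]
    by (cases "(j, q)" rule: cheb_Pi.cases) auto
qed

lemma cheb_Pi_prime:
  assumes "p \<in> cheb_Pi j q"
  shows "prime p" "odd p" "\<not> int p dvd rat_den q"
  using assms by (cases "(j, q)" rule: cheb_Pi.cases; auto simp: odd_primes_def den_primes_def)+

lemma cheb_Pi_eq:
  "cheb_Pi j q = {p. prime p \<and> odd p \<and> (\<exists>c. reduces_to p q c \<and> cheb_order_val p j c)}"
proof (intro Set.set_eqI iffI)
  fix p assume "p \<in> cheb_Pi j q"
  moreover from this have p: "prime p" "odd p" "\<not> int p dvd rat_den q"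
    by (rule cheb_Pi_prime)+
  moreover obtain c where "reduces_to p q c"
    using ex_reduces_to[OF p(1,3)] by blast
  ultimately show "p \<in> {p. prime p \<and> odd p \<and> (\<exists>c. reduces_to p q c \<and> cheb_order_val p j c)}"
    using cheb_Pi_iff by blast
qed (use cheb_Pi_iff in blast)

lemma cheb_Pi_cheb_C_eq:
  assumes "n > 0"
  shows "cheb_Pi j (eval_rat (cheb_C n) q) = {p. prime p \<and> odd p \<and>
    (\<exists>c. reduces_to p q c \<and> cheb_order_val p j (poly (cheb_C n) c))}"
  (is "_ = ?S")
proof (intro Set.set_eqI iffI)
  fix p assume *: "p \<in> cheb_Pi j (eval_rat (cheb_C n) q)"
  then have p: "prime p" "odd p" "\<not> int p dvd rat_den (eval_rat (cheb_C n) q)"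
    by (rule cheb_Pi_prime)+
  then obtain c where "reduces_to p q c"
    \<comment> \<open>The residue must be one of \<open>q\<close> itself, hence the need to exclude
      \<open>p\<close> from the denominator of \<open>q\<close>.\<close>
    using den_cheb_C[OF p(1) assms] ex_reduces_to by blast
  with * p show "p \<in> ?S"
    using cheb_Pi_iff reduces_to_eval_rat by blast
qed (use cheb_Pi_iff reduces_to_eval_rat in blast)

lemma cheb_Pi_minus_eq:
  "cheb_Pi j (- q) =
    {p. prime p \<and> odd p \<and> (\<exists>c. reduces_to p q c \<and> cheb_order_val p j (- c))}"
proof -
  have "(\<exists>c. reduces_to p (- q) c \<and> cheb_order_val p j c) \<longleftrightarrow>
      (\<exists>c. reduces_to p q c \<and> cheb_order_val p j (- c))" if "prime p" for p
    using reduces_to_minus[OF that, of q] reduces_to_minus[OF that, of "- q"]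
    by (metis minus_minus)
  then show ?thesis unfolding cheb_Pi_eq by blast
qed

section \<open>Effect of squaring, odd powers and negation of \<open>t\<close> on the
  valuation\<close>

text \<open>\<open>C_n(C_2(c)) - 2 = C_n(c)^2 - 4\<close> splits into two factors, one for each
  alternative.\<close>

lemma cheb_order_val_0_C_2:
  assumes "prime p"
  shows "cheb_order_val p 0 (poly (cheb_C 2) c) \<longleftrightarrow> cheb_order_val p 0 c \<or> cheb_order_val p 1 c"
proof -
  have "poly (cheb_C n) (poly (cheb_C 2) c) - 2
      = (poly (cheb_C n) c - 2) * (poly (cheb_C n) c + 2)" for n
    unfolding cheb_C_comp mult.commute[of n 2] cheb_C_double
    by (simp add: algebra_simps power2_eq_square)
  then show ?thesis using assms by (auto simp: prime_dvd_mult_iff)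
qed

lemma cheb_order_val_Suc_C_2:
  "cheb_order_val p (Suc k) (poly (cheb_C 2) c) \<longleftrightarrow> cheb_order_val p (Suc (Suc k)) c"
proof -
  have "2 ^ k * n * 2 = 2 ^ Suc k * n" for n :: nat by simp
  then show ?thesis by (simp only: cheb_order_val.simps cheb_C_comp)
qed

text \<open>From \<open>C_n(c)\<close> to \<open>c\<close>, composition multiplies the odd witness
  by \<open>n\<close>. Conversely the same witness works, as \<open>C_n\<close> commutes with the
  other \<open>C_m\<close> and fixes \<open>2\<close> and, \<open>n\<close> being odd,
  \<open>-2\<close>.\<close>

lemma cheb_order_val_C_odd:
  assumes "odd n"
  shows "cheb_order_val p j (poly (cheb_C n) c) \<longleftrightarrow> cheb_order_val p j c"
proof -
  have comm: "poly (cheb_C m) (poly (cheb_C n) c) = poly (cheb_C n) (poly (cheb_C m) c)" for m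
    by (simp add: cheb_C_comp mult.commute)
  have eq_2: "int p dvd poly (cheb_C n) x - 2" if "int p dvd x - 2" for x
    using dvd_trans[OF that diff_dvd_poly_diff[of x 2 "cheb_C n"]] by (simp add: cheb_C_at_2)
  have eq_minus_2: "int p dvd poly (cheb_C n) x + 2" if "int p dvd x + 2" for x
    using dvd_trans[OF _ diff_dvd_poly_diff[of x "- 2" "cheb_C n"]] that assms
    by (simp add: cheb_C_at_minus_2)
  show ?thesis
  proof
    assume "cheb_order_val p j (poly (cheb_C n) c)"
    then show "cheb_order_val p j c"
      using assms by (cases j) (auto simp: cheb_C_comp mult.assoc intro: exI[of _ "_ * n"])
  next
    assume "cheb_order_val p j c"
    then show "cheb_order_val p j (poly (cheb_C n) c)"
      by (cases j) (auto simp: comm intro: eq_2 eq_minus_2)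
  qed
qed

text \<open>Negating the argument exchanges the values \<open>2\<close> and \<open>-2\<close> at odd
  indices, and changes nothing at the even indices \<open>2 ^ Suc k * n\<close>.\<close>

lemma cheb_order_val_minus:
  "cheb_order_val p 0 (- c) \<longleftrightarrow> cheb_order_val p 1 c"
  "cheb_order_val p 1 (- c) \<longleftrightarrow> cheb_order_val p 0 c"
  "cheb_order_val p (Suc (Suc k)) (- c) \<longleftrightarrow> cheb_order_val p (Suc (Suc k)) c"
proof -
  have "int p dvd - x - 2 \<longleftrightarrow> int p dvd x + 2" "int p dvd - x + 2 \<longleftrightarrow> int p dvd x - 2" for x
    using dvd_minus_iff[of "int p" "x + 2"] dvd_minus_iff[of "int p" "x - 2"]
    by (simp_all add: algebra_simps)
  then show "cheb_order_val p 0 (- c) \<longleftrightarrow> cheb_order_val p 1 c"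
    and "cheb_order_val p 1 (- c) \<longleftrightarrow> cheb_order_val p 0 c"
    by (auto simp: cheb_C_minus)
  show "cheb_order_val p (Suc (Suc k)) (- c) \<longleftrightarrow> cheb_order_val p (Suc (Suc k)) c"
    by (simp add: cheb_C_minus)
qed

theorem theorem2:
  fixes q :: rat
  shows
    "(q\<^sup>2 - 2 = eval_rat (cheb_C 2) q
        \<and> cheb_Pi 0 (q\<^sup>2 - 2) = cheb_Pi 0 q \<union> cheb_Pi 1 q
        \<and> (\<forall>k\<ge>1. cheb_Pi k (q\<^sup>2 - 2) = cheb_Pi (k + 1) q))
     \<and> (\<forall>n j. odd n \<longrightarrow> cheb_Pi j (eval_rat (cheb_C n) q) = cheb_Pi j q)
     \<and> ((\<forall>i\<in>{0, 1}. cheb_Pi i (- q) = cheb_Pi (1 - i) q)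
        \<and> (\<forall>j\<ge>2. cheb_Pi j (- q) = cheb_Pi j q))"
proof (intro conjI allI impI ballI)
  show "q\<^sup>2 - 2 = eval_rat (cheb_C 2) q" by (simp add: eval_rat_cheb_C_2)
  show "cheb_Pi 0 (q\<^sup>2 - 2) = cheb_Pi 0 q \<union> cheb_Pi 1 q"
    unfolding eval_rat_cheb_C_2[symmetric] cheb_Pi_cheb_C_eq[OF zero_less_numeral] cheb_Pi_eq[of _ q]
    using cheb_order_val_0_C_2 by blast
next
  fix k :: nat assume "k \<ge> 1"
  then obtain k' where "k = Suc k'" by (cases k) auto
  then show "cheb_Pi k (q\<^sup>2 - 2) = cheb_Pi (k + 1) q"
    unfolding eval_rat_cheb_C_2[symmetric] cheb_Pi_cheb_C_eq[OF zero_less_numeral] cheb_Pi_eq[of _ q]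
    by (simp only: cheb_order_val_Suc_C_2 Suc_eq_plus1[symmetric])
next
  fix n j :: nat assume "odd n"
  then show "cheb_Pi j (eval_rat (cheb_C n) q) = cheb_Pi j q"
    by (simp add: cheb_Pi_cheb_C_eq odd_pos cheb_order_val_C_odd cheb_Pi_eq[of _ q]
        del: cheb_Pi.simps cheb_order_val.simps)
next
  fix i :: nat assume "i \<in> {0, 1}"
  then consider "i = 0" | "i = 1" by blast
  then show "cheb_Pi i (- q) = cheb_Pi (1 - i) q"
    by cases (simp_all only: cheb_Pi_minus_eq cheb_Pi_eq[of _ q] cheb_order_val_minus diff_zero diff_self_eq_0)
next
  fix j :: nat assume "j \<ge> 2"
  then obtain k where "j = Suc (Suc k)" using that[of "j - 2"] by simp
  then show "cheb_Pi j (- q) = cheb_Pi j q"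
    by (simp only: cheb_Pi_minus_eq cheb_Pi_eq[of _ q] cheb_order_val_minus)
qed

end
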